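(* Let $G$ be a $K_4$-free graph with $n$ vertices. Then $G$ can be made bipartite by deleting at most $n^2/9$ edges. Moreover, the only extremal graph which requires deletion of that many edges is the complete $3$-partite graph with parts of size $n/3$; that is, every set of edges of $G$ whose deletion makes $G$ bipartite has size at least $n^2/9$ if and only if $3$ divides $n$ and $G$ is (isomorphic to) the complete $3$-partite graph with all three parts of size $n/3$.
   Context: Graphs are finite, simple and undirected, with $n\ge 1$ vertices. A graph is $K_4$-free if it contains no four pairwise adjacent vertices. Deleting edges means removing edges while keeping all vertices. *)

theory Defs
  imports Complex_Main "HOL-Library.Ramsey"
begin

text \<open>
  A graph is given by its vertex set \<open>V\<close> and its set \<open>E\<close> of edges, each edge being a
  two-element subset of \<open>V\<close>; \<open>clique\<close> and \<open>indep\<close> are the notions of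
  \<^theory>\<open>HOL-Library.Ramsey\<close> for this representation.
\<close>

definition simple_graph :: "'a set \<Rightarrow> 'a set set \<Rightarrow> bool" where
  "simple_graph V E \<longleftrightarrow> finite V \<and> V \<noteq> {} \<and> E \<subseteq> [V]\<^bsup>2\<^esup>"

definition K4_free :: "'a set \<Rightarrow> 'a set set \<Rightarrow> bool" where
  "K4_free V E \<longleftrightarrow> \<not> (\<exists>K\<subseteq>V. card K = 4 \<and> clique K E)"

text \<open>A colour class of a bipartite graph may be empty.\<close>

definition bipartite :: "'a set \<Rightarrow> 'a set set \<Rightarrow> bool" where
  "bipartite V E \<longleftrightarrow> (\<exists>A B. A \<union> B = V \<and> A \<inter> B = {} \<and> indep A E \<and> indep B E)"

definition graph_isomorphic ::
  "'a set \<Rightarrow> 'a set set \<Rightarrow> 'b set \<Rightarrow> 'b set set \<Rightarrow> bool" where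
  "graph_isomorphic V E V' E' \<longleftrightarrow>
     (\<exists>f. bij_betw f V V' \<and> (\<forall>u\<in>V. \<forall>v\<in>V. {u, v} \<in> E \<longleftrightarrow> {f u, f v} \<in> E'))"

text \<open>
  The complete 3-partite graph with parts of sizes \<open>a\<close>, \<open>b\<close>, \<open>c\<close>: the first component of
  a vertex names its part.
\<close>

definition tripartite_verts :: "nat \<Rightarrow> nat \<Rightarrow> nat \<Rightarrow> (nat \<times> nat) set" where
  "tripartite_verts a b c = {0} \<times> {..<a} \<union> {1} \<times> {..<b} \<union> {2} \<times> {..<c}"

definition tripartite_edges :: "nat \<Rightarrow> nat \<Rightarrow> nat \<Rightarrow> (nat \<times> nat) set set" where
  "tripartite_edges a b c =
     {{x, y} | x y. x \<in> tripartite_verts a b c \<and> y \<in> tripartite_verts a b c \<and> fst x \<noteq> fst y}"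

end

theory Submission
  imports Defs "HOL-Analysis.Convex"
begin

text \<open>
  Let \<open>G\<close> have \<open>n\<close> vertices, \<open>m\<close> edges and \<open>t\<close> triangles. A bipartition loses the edges inside
  its two sides, and it may be chosen at random with independent vertices: replacing the
  probabilities one at a time by 0 or 1 never has to increase the expected loss
  (\<open>bipartite_by_fractional_cut\<close>). Three kinds of random bipartitions suffice.

  \<^item> Fair coins lose \<open>m / 2\<close> edges, which settles \<open>m < 2 n\<^sup>2 / 9\<close>.

  \<^item> The neighbourhood of a vertex against the rest loses on average at most
    \<open>m - 4 m\<^sup>2 / n\<^sup>2 + 6 t / n\<close> edges (\<open>neighbourhood_cut\<close>). This is good if there are few triangles.

  \<^item> For a triangle, the common neighbourhoods of its three pairs of vertices are independent,
    and disjoint because \<open>G\<close> is \<open>K\<^sub>4\<close>-free. Let \<open>R\<close> consist of the other vertices. Put one of the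
    three sets on one side, the other two on the other side, and let each vertex of \<open>R\<close> join the
    single set with probability \<open>p\<close>. On average over the three choices at most
    \<open>((2 - p) m + (1 - 5 p + 6 p\<^sup>2) e(R)) / 3\<close> edges are lost (\<open>triangle_cut\<close>). Double counting
    gives a triangle with \<open>\<bar>R\<bar> \<le> n - 9 t / m\<close>, and \<open>e(R) \<le> \<bar>R\<bar>\<^sup>2 / 3\<close> is Turan's bound. This is
    good if there are many triangles.

  With \<open>x = m / n\<^sup>2\<close>, elementary estimates show that for \<open>2 / 9 \<le> x < 1 / 3\<close> the second cut or
  the third one, with \<open>p = 1\<close> or \<open>p = 3 / 4\<close>, loses fewer than \<open>n\<^sup>2 / 9\<close> edges
  (\<open>cut_bounds_incompatible\<close>). As \<open>x \<le> 1 / 3\<close> by Turan's bound, only \<open>m = n\<^sup>2 / 3\<close> remains. There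
  every estimate on the way to Turan's bound is an equality, so some triangle has \<open>R = {}\<close>, and
  \<open>G\<close> is complete tripartite with equal parts (\<open>extremal_is_balanced_tripartite\<close>). Conversely, a
  Latin square of order \<open>k\<close> describes \<open>k\<^sup>2\<close> edge-disjoint triangles in the complete tripartite
  graph with parts of size \<open>k\<close>, and each of them has to lose an edge.
\<close>

section \<open>Rounding fractional cuts\<close>

text \<open>
  This is the expected number of edges inside a side of the bipartition if each vertex \<open>x\<close>
  independently goes to the first side with probability \<open>w x\<close>.
\<close>

definition fractional_loss :: "'a set set \<Rightarrow> ('a \<Rightarrow> real) \<Rightarrow> real" where
  "fractional_loss E w = (\<Sum>e\<in>E. (\<Prod>x\<in>e. w x) + (\<Prod>x\<in>e. 1 - w x))"

lemma prod_fun_upd_affine: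
  fixes w :: "'a \<Rightarrow> real"
  assumes "finite e"
  shows "(\<Prod>x\<in>e. (w(v := s)) x) =
    (1 - s) * (\<Prod>x\<in>e. (w(v := 0)) x) + s * (\<Prod>x\<in>e. (w(v := 1)) x)"
proof (cases "v \<in> e")
  case True
  have "(\<Prod>x\<in>e. (w(v := r)) x) = r * (\<Prod>x\<in>e - {v}. w x)" for r
    using assms True by (subst prod.remove[of e v]) auto
  then show ?thesis by simp
next
  case False
  then have "(\<Prod>x\<in>e. (w(v := r)) x) = (\<Prod>x\<in>e. w x)" for r
    by (intro prod.cong) auto
  from this[of s] this[of 0] this[of 1] show ?thesis by (simp add: algebra_simps)
qed

lemma fractional_loss_affine:
  assumes "\<And>e. e \<in> E \<Longrightarrow> finite e"
  shows "fractional_loss E (w(v := s)) =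
    (1 - s) * fractional_loss E (w(v := 0)) + s * fractional_loss E (w(v := 1))"
proof -
  have compl: "(\<Prod>x\<in>e. 1 - (w(v := r)) x) = (\<Prod>x\<in>e. ((\<lambda>x. 1 - w x)(v := 1 - r)) x)" for e r
    by (intro prod.cong) auto
  have "(\<Prod>x\<in>e. (w(v := s)) x) + (\<Prod>x\<in>e. 1 - (w(v := s)) x) =
    (1 - s) * ((\<Prod>x\<in>e. (w(v := 0)) x) + (\<Prod>x\<in>e. 1 - (w(v := 0)) x)) +
    s * ((\<Prod>x\<in>e. (w(v := 1)) x) + (\<Prod>x\<in>e. 1 - (w(v := 1)) x))" if "e \<in> E" for e
    using prod_fun_upd_affine[OF assms[OF that], of w v s]
      prod_fun_upd_affine[OF assms[OF that], of "\<lambda>x. 1 - w x" v "1 - s"]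
    unfolding compl by (simp add: algebra_simps)
  then have "fractional_loss E (w(v := s)) =
    (\<Sum>e\<in>E. (1 - s) * ((\<Prod>x\<in>e. (w(v := 0)) x) + (\<Prod>x\<in>e. 1 - (w(v := 0)) x)) +
      s * ((\<Prod>x\<in>e. (w(v := 1)) x) + (\<Prod>x\<in>e. 1 - (w(v := 1)) x)))"
    unfolding fractional_loss_def by (rule sum.cong[OF refl])
  then show ?thesis
    unfolding fractional_loss_def sum.distrib by (simp only: sum.distrib flip: sum_distrib_left)
qed

text \<open>
  Since the expected loss is affine in each single probability, one of the values 0 and 1 for
  that probability is at least as good as the given one.
\<close>

lemma fractional_loss_rounding:
  assumes "finite V" and "\<And>e. e \<in> E \<Longrightarrow> finite e"
    and "\<And>x. x \<in> V \<Longrightarrow> 0 \<le> w x \<and> w x \<le> 1"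
  shows "\<exists>w'. (\<forall>x\<in>V. w' x = 0 \<or> w' x = 1) \<and> (\<forall>x. x \<notin> V \<longrightarrow> w' x = w x) \<and>
    fractional_loss E w' \<le> fractional_loss E w"
  using assms(1,3)
proof (induction V rule: finite_induct)
  case empty
  then show ?case by auto
next
  case (insert v V)
  then obtain w' where w': "\<forall>x\<in>V. w' x = 0 \<or> w' x = 1" "\<forall>x. x \<notin> V \<longrightarrow> w' x = w x"
    "fractional_loss E w' \<le> fractional_loss E w"
    by auto
  define L0 L1 where "L0 = fractional_loss E (w'(v := 0))" and "L1 = fractional_loss E (w'(v := 1))"
  have s: "0 \<le> w' v" "w' v \<le> 1"
    using w'(2) insert.hyps insert.prems by auto
  have "fractional_loss E w' = (1 - w' v) * L0 + w' v * L1"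
    using fractional_loss_affine[OF assms(2), of E w' v "w' v"] by (simp add: L0_def L1_def)
  moreover have "min L0 L1 \<le> (1 - w' v) * L0 + w' v * L1"
    using mult_left_mono[of "min L0 L1" L0 "1 - w' v"] mult_left_mono[of "min L0 L1" L1 "w' v"] s
    by (simp add: algebra_simps)
  ultimately have "L0 \<le> fractional_loss E w' \<or> L1 \<le> fractional_loss E w'"
    by linarith
  then obtain b where b: "b = 0 \<or> b = 1" "fractional_loss E (w'(v := b)) \<le> fractional_loss E w'"
    unfolding L0_def L1_def by blast
  show ?case
  proof (intro exI[of _ "w'(v := b)"] conjI)
    show "fractional_loss E (w'(v := b)) \<le> fractional_loss E w"
      using b(2) w'(3) by linarith
    show "\<forall>x\<in>insert v V. (w'(v := b)) x = 0 \<or> (w'(v := b)) x = 1"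
      using b(1) w'(1) by simp
    show "\<forall>x. x \<notin> insert v V \<longrightarrow> (w'(v := b)) x = w x"
      using w'(2) by simp
  qed
qed

lemma bipartite_by_fractional_cut:
  assumes "finite V" and "E \<subseteq> [V]\<^bsup>2\<^esup>" and w: "\<And>x. x \<in> V \<Longrightarrow> 0 \<le> w x \<and> w x \<le> 1"
  shows "\<exists>D\<subseteq>E. bipartite V (E - D) \<and> real (card D) \<le> fractional_loss E w"
proof -
  have fin: "finite e" "e \<subseteq> V" "e \<noteq> {}" if "e \<in> E" for e
    using assms(2) that by (auto simp: nsets_def)
  have finE: "finite E"
    using assms(1,2) finite_imp_finite_nsets finite_subset by blast
  obtain w' where w': "\<forall>x\<in>V. w' x = 0 \<or> w' x = 1" "fractional_loss E w' \<le> fractional_loss E w"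
    using fractional_loss_rounding[of V E w, OF assms(1) fin(1) w] by auto
  define A B where "A = {x \<in> V. w' x = 1}" and "B = {x \<in> V. w' x = 0}"
  define D where "D = {e \<in> E. e \<subseteq> A \<or> e \<subseteq> B}"
  have DE: "D \<subseteq> E" by (auto simp: D_def)
  have "(\<Prod>x\<in>e. w' x) + (\<Prod>x\<in>e. 1 - w' x) = of_bool (e \<in> D)" if e: "e \<in> E" for e
  proof -
    have 1: "(\<Prod>x\<in>e. w' x) = of_bool (e \<subseteq> A)"
    proof (cases "e \<subseteq> A")
      case True
      then have "(\<Prod>x\<in>e. w' x) = 1" by (intro prod.neutral) (auto simp: A_def)
      then show ?thesis using True by simp
    next
      case False
      then obtain x where "x \<in> e" "w' x = 0" using w'(1) fin[OF e] by (auto simp: A_def)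
      then show ?thesis using False fin[OF e] by auto
    qed
    have 2: "(\<Prod>x\<in>e. 1 - w' x) = of_bool (e \<subseteq> B)"
    proof (cases "e \<subseteq> B")
      case True
      then have "(\<Prod>x\<in>e. 1 - w' x) = 1" by (intro prod.neutral) (auto simp: B_def)
      then show ?thesis using True by simp
    next
      case False
      then obtain x where "x \<in> e" "w' x = 1" using w'(1) fin[OF e] by (auto simp: B_def)
      then have "(\<Prod>x\<in>e. 1 - w' x) = 0" using fin[OF e] by auto
      then show ?thesis using False by simp
    qed
    have "\<not> (e \<subseteq> A \<and> e \<subseteq> B)" using fin[OF e] by (fastforce simp: A_def B_def)
    then show ?thesis unfolding 1 2 using e by (auto simp: D_def)
  qed
  then have "fractional_loss E w' = (\<Sum>e\<in>E. of_bool (e \<in> D))"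
    unfolding fractional_loss_def by (intro sum.cong) auto
  also have "\<dots> = real (card D)"
    using finE DE by (simp add: Int_absorb1)
  finally have "real (card D) \<le> fractional_loss E w" using w' by simp
  moreover have "bipartite V (E - D)"
    unfolding bipartite_def
  proof (intro exI conjI)
    show "A \<union> B = V" "A \<inter> B = {}" using w'(1) by (auto simp: A_def B_def)
    have no: "{x, y} \<notin> E - D" if "x \<in> A \<and> y \<in> A \<or> x \<in> B \<and> y \<in> B" for x y
      using that by (auto simp: D_def)
    show "indep A (E - D)" "indep B (E - D)"
      using no unfolding indep_def by auto
  qed
  ultimately show ?thesis using DE by blast
qed

text \<open>
  All counting is done with sums of 0-1-valued reals over ordered tuples of vertices, so that
  edges are counted twice and triangles six times.
\<close>

definition adj :: "'a set set \<Rightarrow> 'a \<Rightarrow> 'a \<Rightarrow> real" where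
  "adj E x y = of_bool ({x, y} \<in> E)"

lemma sum_over_ordered_edges:
  fixes F :: "'a set \<Rightarrow> real"
  assumes "finite V" and "E \<subseteq> [V]\<^bsup>2\<^esup>"
  shows "(\<Sum>x\<in>V. \<Sum>y\<in>V. adj E x y * F {x, y}) = 2 * (\<Sum>e\<in>E. F e)"
proof -
  have finE: "finite E"
    using assms finite_imp_finite_nsets finite_subset by blast
  define P where "P = {p \<in> V \<times> V. {fst p, snd p} \<in> E}"
  have "(\<Sum>x\<in>V. \<Sum>y\<in>V. adj E x y * F {x, y}) =
    (\<Sum>p\<in>V \<times> V. adj E (fst p) (snd p) * F {fst p, snd p})"
    by (simp add: sum.cartesian_product case_prod_beta)
  also have "\<dots> = (\<Sum>p\<in>P. F {fst p, snd p})"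
    using assms(1) by (intro sum.mono_neutral_cong_right) (auto simp: P_def adj_def)
  also have "\<dots> = (\<Sum>e\<in>E. \<Sum>p | p \<in> P \<and> {fst p, snd p} = e. F {fst p, snd p})"
    using assms(1) finE by (intro sum.group[symmetric]) (auto simp: P_def)
  also have "\<dots> = (\<Sum>e\<in>E. 2 * F e)"
  proof (intro sum.cong refl)
    fix e assume e: "e \<in> E"
    then obtain x y where xy: "e = {x, y}" "x \<in> V" "y \<in> V" "x \<noteq> y"
      using assms(2) nsets2_E by blast
    have "{p. p \<in> P \<and> {fst p, snd p} = e} = {(x, y), (y, x)}"
      using e xy by (auto simp: P_def doubleton_eq_iff insert_commute)
    then show "(\<Sum>p | p \<in> P \<and> {fst p, snd p} = e. F {fst p, snd p}) = 2 * F e"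
      using xy by (simp add: insert_commute)
  qed
  finally show ?thesis by (simp add: sum_distrib_left)
qed

lemma bipartite_by_ordered_sum:
  assumes "finite V" and "E \<subseteq> [V]\<^bsup>2\<^esup>" and "\<And>x. x \<in> V \<Longrightarrow> 0 \<le> w x \<and> w x \<le> 1"
  shows "\<exists>D\<subseteq>E. bipartite V (E - D) \<and>
    2 * real (card D) \<le> (\<Sum>x\<in>V. \<Sum>y\<in>V. adj E x y * (w x * w y + (1 - w x) * (1 - w y)))"
proof -
  have "(\<Sum>x\<in>V. \<Sum>y\<in>V. adj E x y * (w x * w y + (1 - w x) * (1 - w y))) =
    (\<Sum>x\<in>V. \<Sum>y\<in>V. adj E x y * ((\<Prod>u\<in>{x, y}. w u) + (\<Prod>u\<in>{x, y}. 1 - w u)))"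
  proof (intro sum.cong refl)
    fix x y
    have "adj E x y = 0 \<or> x \<noteq> y"
      using assms(2) by (auto simp: adj_def nsets_def)
    then show "adj E x y * (w x * w y + (1 - w x) * (1 - w y)) =
      adj E x y * ((\<Prod>u\<in>{x, y}. w u) + (\<Prod>u\<in>{x, y}. 1 - w u))"
      by auto
  qed
  also have "\<dots> = 2 * fractional_loss E w"
    unfolding fractional_loss_def by (rule sum_over_ordered_edges[OF assms(1,2)])
  finally show ?thesis
    using bipartite_by_fractional_cut[OF assms] by simp
qed

section \<open>Counting triangles in a graph without four pairwise adjacent vertices\<close>

locale K4_free_adjacency =
  fixes a :: "'a \<Rightarrow> 'a \<Rightarrow> real"
  assumes zero_one: "a x y = 0 \<or> a x y = 1"
    and sym: "a x y = a y x"
    and K4_free: "\<not> (a x y = 1 \<and> a x z = 1 \<and> a x u = 1 \<and> a y z = 1 \<and> a y u = 1 \<and> a z u = 1)"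
begin

definition deg :: "'a set \<Rightarrow> 'a \<Rightarrow> real" where
  "deg S x = (\<Sum>y\<in>S. a x y)"

definition codeg :: "'a set \<Rightarrow> 'a \<Rightarrow> 'a \<Rightarrow> real" where
  "codeg S x y = (\<Sum>z\<in>S. a x z * a y z)"

definition ordered_edges :: "'a set \<Rightarrow> real" where
  "ordered_edges S = (\<Sum>x\<in>S. \<Sum>y\<in>S. a x y)"

definition ordered_triangles :: "'a set \<Rightarrow> real" where
  "ordered_triangles S = (\<Sum>x\<in>S. \<Sum>y\<in>S. a x y * codeg S x y)"

lemma nonneg: "0 \<le> a x y" and le_one: "a x y \<le> 1"
  using zero_one[of x y] by auto

lemma codeg_nonneg: "0 \<le> codeg S x y"
  unfolding codeg_def by (intro sum_nonneg mult_nonneg_nonneg nonneg)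

lemma ordered_edges_nonneg: "0 \<le> ordered_edges S"
  unfolding ordered_edges_def by (intro sum_nonneg nonneg)

lemma ordered_triangles_nonneg: "0 \<le> ordered_triangles S"
  unfolding ordered_triangles_def by (intro sum_nonneg mult_nonneg_nonneg nonneg codeg_nonneg)

lemma ordered_edges_eq_sum_deg: "ordered_edges S = (\<Sum>x\<in>S. deg S x)"
  unfolding ordered_edges_def deg_def ..

lemma sum_deg_over_edges:
  "(\<Sum>x\<in>S. \<Sum>y\<in>S. a x y * deg S x) = (\<Sum>x\<in>S. (deg S x)\<^sup>2)"
  "(\<Sum>x\<in>S. \<Sum>y\<in>S. a x y * deg S y) = (\<Sum>x\<in>S. (deg S x)\<^sup>2)"
proof -
  show 1: "(\<Sum>x\<in>S. \<Sum>y\<in>S. a x y * deg S x) = (\<Sum>x\<in>S. (deg S x)\<^sup>2)"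
    by (simp add: power2_eq_square deg_def flip: sum_distrib_right)
  show "(\<Sum>x\<in>S. \<Sum>y\<in>S. a x y * deg S y) = (\<Sum>x\<in>S. (deg S x)\<^sup>2)"
    unfolding 1[symmetric] by (subst sum.swap) (simp add: sym)
qed

text \<open>
  The two neighbourhoods overlap in the common neighbourhood, and their union has at most
  \<open>card S\<close> elements.
\<close>

lemma sum_deg_le: "deg S x + deg S y \<le> card S + codeg S x y"
proof -
  have "deg S x + deg S y = (\<Sum>z\<in>S. a x z + a y z)"
    by (simp add: deg_def sum.distrib)
  also have "\<dots> \<le> (\<Sum>z\<in>S. 1 + a x z * a y z)"
  proof (rule sum_mono)
    fix z show "a x z + a y z \<le> 1 + a x z * a y z"
      using zero_one[of x z] zero_one[of y z] by auto
  qed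
  also have "\<dots> = card S + codeg S x y"
    by (simp add: codeg_def sum.distrib)
  finally show ?thesis .
qed

lemma ordered_edges_squared_le_sum_deg_squared:
  "(ordered_edges S)\<^sup>2 \<le> card S * (\<Sum>x\<in>S. (deg S x)\<^sup>2)"
  unfolding ordered_edges_eq_sum_deg
  using sum_squared_le_sum_of_squares[of "deg S" S] by (simp add: mult.commute)

lemma sum_deg_squared_le:
  "2 * (\<Sum>x\<in>S. (deg S x)\<^sup>2) \<le> card S * ordered_edges S + ordered_triangles S"
proof -
  have "2 * (\<Sum>x\<in>S. (deg S x)\<^sup>2) = (\<Sum>x\<in>S. \<Sum>y\<in>S. a x y * (deg S x + deg S y))"
    by (simp add: distrib_left sum.distrib sum_deg_over_edges)
  also have "\<dots> \<le> (\<Sum>x\<in>S. \<Sum>y\<in>S. a x y * (card S + codeg S x y))"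
    by (intro sum_mono mult_left_mono sum_deg_le nonneg)
  also have "\<dots> = card S * ordered_edges S + ordered_triangles S"
    by (simp add: distrib_left sum.distrib ordered_edges_def ordered_triangles_def
        sum_distrib_left mult.commute)
  finally show ?thesis .
qed

definition codeg_sum :: "'a set \<Rightarrow> 'a \<Rightarrow> 'a \<Rightarrow> 'a \<Rightarrow> real" where
  "codeg_sum S x y z = codeg S x y + codeg S y z + codeg S x z"

text \<open>
  The three products are the indicators of the common neighbourhoods of the sides of a triangle.
  A vertex in two of these sets would form a \<open>K\<^sub>4\<close> with the triangle.
\<close>

lemma common_neighbourhoods_disjoint:
  assumes "a x y = 1" "a y z = 1" "a x z = 1"
  shows "a x u * a y u + a y u * a z u + a x u * a z u \<in> {0, 1}"
  using K4_free[of x y z u] assms zero_one[of x u] zero_one[of y u] zero_one[of z u] by auto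

lemma codeg_sum_le:
  assumes "a x y = 1" "a y z = 1" "a x z = 1"
  shows "codeg_sum S x y z \<le> card S"
proof -
  have "codeg_sum S x y z = (\<Sum>u\<in>S. a x u * a y u + a y u * a z u + a x u * a z u)"
    by (simp add: codeg_sum_def codeg_def sum.distrib)
  also have "\<dots> \<le> (\<Sum>u\<in>S. 1)"
  proof (rule sum_mono)
    fix u show "a x u * a y u + a y u * a z u + a x u * a z u \<le> 1"
      using common_neighbourhoods_disjoint[OF assms, of u] by auto
  qed
  finally show ?thesis by simp
qed

text \<open>
  Both sides count the pairs of a triangle and a common neighbour of one of its sides, on the
  right grouped by that side.
\<close>

lemma sum_codeg_sum:
  "(\<Sum>x\<in>S. \<Sum>y\<in>S. \<Sum>z\<in>S. a x y * a y z * a x z * codeg_sum S x y z) =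
    3 * (\<Sum>x\<in>S. \<Sum>y\<in>S. a x y * (codeg S x y)\<^sup>2)"
proof -
  define Q where "Q = (\<Sum>x\<in>S. \<Sum>y\<in>S. a x y * (codeg S x y)\<^sup>2)"
  have xy: "(\<Sum>x\<in>S. \<Sum>y\<in>S. \<Sum>z\<in>S. a x y * a y z * a x z * codeg S x y) = Q"
    unfolding Q_def
  proof (intro sum.cong refl)
    fix x y
    have "(\<Sum>z\<in>S. a x y * a y z * a x z * codeg S x y) =
      a x y * codeg S x y * (\<Sum>z\<in>S. a x z * a y z)"
      unfolding sum_distrib_left by (intro sum.cong refl) (simp add: mult_ac)
    then show "(\<Sum>z\<in>S. a x y * a y z * a x z * codeg S x y) = a x y * (codeg S x y)\<^sup>2"
      by (simp add: codeg_def power2_eq_square)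
  qed
  have xz: "(\<Sum>x\<in>S. \<Sum>y\<in>S. \<Sum>z\<in>S. a x y * a y z * a x z * codeg S x z) = Q"
    unfolding xy[symmetric]
  proof (rule sum.cong[OF refl])
    fix x
    show "(\<Sum>y\<in>S. \<Sum>z\<in>S. a x y * a y z * a x z * codeg S x z) =
      (\<Sum>y\<in>S. \<Sum>z\<in>S. a x y * a y z * a x z * codeg S x y)"
      by (subst sum.swap) (simp add: mult_ac sym)
  qed
  have yz: "(\<Sum>x\<in>S. \<Sum>y\<in>S. \<Sum>z\<in>S. a x y * a y z * a x z * codeg S y z) = Q"
    unfolding xz[symmetric]
    by (subst sum.swap) (simp add: mult_ac sym)
  show ?thesis
    unfolding codeg_sum_def distrib_left sum.distrib xy xz yz Q_def[symmetric] by simp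
qed

lemma sum_triangles: "(\<Sum>x\<in>S. \<Sum>y\<in>S. \<Sum>z\<in>S. a x y * a y z * a x z) = ordered_triangles S"
  unfolding ordered_triangles_def codeg_def sum_distrib_left by (simp add: mult_ac)

lemma ordered_triangles_squared_le:
  "(ordered_triangles S)\<^sup>2 \<le> ordered_edges S * (\<Sum>x\<in>S. \<Sum>y\<in>S. a x y * (codeg S x y)\<^sup>2)"
proof -
  define A C where "A p = a (fst p) (snd p)" and "C p = codeg S (fst p) (snd p)" for p
  have A: "A p * (A p * C p) = A p * C p" "(A p)\<^sup>2 = A p" "(A p * C p)\<^sup>2 = A p * (C p)\<^sup>2" for p
    using zero_one[of "fst p" "snd p"] by (auto simp: A_def)
  show ?thesis
    using Cauchy_Schwarz_ineq_sum[of A "\<lambda>p. A p * C p" "S \<times> S"]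
    unfolding A ordered_triangles_def ordered_edges_def sum.cartesian_product
    by (simp only: A_def C_def case_prod_unfold)
qed

text \<open>
  By the Cauchy-Schwarz inequality, \<open>codeg_sum\<close> has average at least
  \<open>3 * ordered_triangles S / ordered_edges S\<close> over all triangles: an edge lies on average in
  \<open>ordered_triangles S / ordered_edges S\<close> triangles, and choosing a random triangle favours edges
  in many triangles.
\<close>

lemma triangle_with_large_codeg_sum:
  assumes "finite S" and "0 < ordered_triangles S"
  shows "\<exists>x\<in>S. \<exists>y\<in>S. \<exists>z\<in>S. a x y = 1 \<and> a y z = 1 \<and> a x z = 1 \<and>
    3 * ordered_triangles S \<le> ordered_edges S * codeg_sum S x y z"
proof (rule ccontr)
  define T M where "T = ordered_triangles S" and "M = ordered_edges S"
  assume neg: "\<not> ?thesis"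
  let ?t = "\<lambda>x y z. a x y * a y z * a x z"
  have lt: "M * codeg_sum S x y z < 3 * T" if "x \<in> S" "y \<in> S" "z \<in> S" "?t x y z \<noteq> 0" for x y z
  proof -
    have "a x y = 1" "a y z = 1" "a x z = 1"
      using that(4) zero_one[of x y] zero_one[of y z] zero_one[of x z] by auto
    with neg that(1-3) show ?thesis unfolding T_def M_def not_le[symmetric] by blast
  qed
  have t: "0 \<le> ?t x y z" for x y z
    by (intro mult_nonneg_nonneg nonneg)
  have "\<exists>x\<in>S. \<exists>y\<in>S. \<exists>z\<in>S. ?t x y z \<noteq> 0"
  proof (rule ccontr)
    assume "\<not> ?thesis"
    then have "T = 0" unfolding T_def sum_triangles[symmetric] by (intro sum.neutral ballI) auto
    then show False using assms by (simp add: T_def)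
  qed
  then obtain x0 y0 z0 where 0: "x0 \<in> S" "y0 \<in> S" "z0 \<in> S" "?t x0 y0 z0 \<noteq> 0" by blast
  define f where "f p = ?t (fst p) (fst (snd p)) (snd (snd p))" for p
  define g where "g p = codeg_sum S (fst p) (fst (snd p)) (snd (snd p))" for p
  have "(\<Sum>p\<in>S \<times> S \<times> S. f p * (M * g p)) < (\<Sum>p\<in>S \<times> S \<times> S. f p * (3 * T))"
  proof (rule sum_strict_mono_ex1)
    show "\<forall>p\<in>S \<times> S \<times> S. f p * (M * g p) \<le> f p * (3 * T)"
    proof
      fix p assume p: "p \<in> S \<times> S \<times> S"
      show "f p * (M * g p) \<le> f p * (3 * T)"
      proof (cases "f p = 0")
        case False
        then have "M * g p \<le> 3 * T"
          using lt[of "fst p" "fst (snd p)" "snd (snd p)"] p by (auto simp: f_def g_def)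
        then show ?thesis using t by (intro mult_left_mono) (auto simp: f_def)
      qed simp
    qed
    show "\<exists>p\<in>S \<times> S \<times> S. f p * (M * g p) < f p * (3 * T)"
    proof
      have "0 < f (x0, y0, z0)" using t[of x0 y0 z0] 0(4)
        unfolding f_def fst_conv snd_conv by linarith
      moreover have "M * g (x0, y0, z0) < 3 * T" using lt[OF 0] by (simp add: g_def)
      ultimately show "f (x0, y0, z0) * (M * g (x0, y0, z0)) < f (x0, y0, z0) * (3 * T)"
        by (rule mult_strict_left_mono[rotated])
      show "(x0, y0, z0) \<in> S \<times> S \<times> S" using 0 by simp
    qed
  qed (use assms in auto)
  moreover have "(\<Sum>p\<in>S \<times> S \<times> S. f p * (M * g p)) =
    M * (\<Sum>x\<in>S. \<Sum>y\<in>S. \<Sum>z\<in>S. ?t x y z * codeg_sum S x y z)"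
    by (simp add: f_def g_def sum.cartesian_product case_prod_beta sum_distrib_left mult_ac)
  moreover have "(\<Sum>p\<in>S \<times> S \<times> S. f p * (3 * T)) = 3 * T * T"
    by (simp add: T_def f_def sum.cartesian_product case_prod_beta flip: sum_triangles sum_distrib_right)
  ultimately have "M * (3 * (\<Sum>x\<in>S. \<Sum>y\<in>S. a x y * (codeg S x y)\<^sup>2)) < 3 * T * T"
    unfolding sum_codeg_sum by simp
  with ordered_triangles_squared_le[of S] show False
    by (simp add: T_def M_def power2_eq_square)
qed

lemma ordered_triangles_le:
  assumes "finite S"
  shows "3 * ordered_triangles S \<le> ordered_edges S * card S"
proof (cases "ordered_triangles S = 0")
  case True
  then show ?thesis using ordered_edges_nonneg[of S] by simp
next
  case False
  then have "0 < ordered_triangles S" using ordered_triangles_nonneg[of S] by simp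
  from triangle_with_large_codeg_sum[OF assms this] obtain x y z
    where "a x y = 1" "a y z = 1" "a x z = 1"
      and le: "3 * ordered_triangles S \<le> ordered_edges S * codeg_sum S x y z" by blast
  then have "codeg_sum S x y z \<le> card S" by (intro codeg_sum_le)
  then show ?thesis
    using le mult_left_mono[OF _ ordered_edges_nonneg] by (meson order_trans)
qed

text \<open>
  This is Turan's bound \<open>\<bar>S\<bar>\<^sup>2 / 3\<close> on the number of edges. Many edges force large degrees, hence
  large common neighbourhoods and many triangles, whereas the disjointness of the common
  neighbourhoods of the sides of a triangle bounds the number of triangles from above.
\<close>

lemma turan:
  assumes "finite S"
  shows "3 * ordered_edges S \<le> 2 * (card S)\<^sup>2"
proof (cases "ordered_edges S = 0")
  case False
  define N M T where "N = real (card S)" and "M = ordered_edges S" and "T = ordered_triangles S"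
  have M: "0 < M" using False ordered_edges_nonneg[of S] by (simp add: M_def)
  have "2 * M\<^sup>2 \<le> N * (2 * (\<Sum>x\<in>S. (deg S x)\<^sup>2))"
    using ordered_edges_squared_le_sum_deg_squared[of S] by (simp add: M_def N_def)
  also have "\<dots> \<le> N * (N * M + T)"
    using sum_deg_squared_le[of S] by (intro mult_left_mono) (auto simp: M_def N_def T_def)
  also have "\<dots> \<le> N * (N * M + M * N / 3)"
    using ordered_triangles_le[OF assms]
    by (intro add_left_mono mult_left_mono) (simp_all add: M_def N_def T_def field_simps)
  finally have "M * (3 * M) \<le> M * (2 * N\<^sup>2)"
    by (simp add: power2_eq_square algebra_simps)
  then show ?thesis using M by (simp add: M_def N_def)
qed simp

end

section \<open>Three families of fractional cuts\<close>

context K4_free_adjacency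
begin

text \<open>
  Ordered pairs count every lost edge twice, so a bipartition that deletes at most \<open>n\<^sup>2 / 9\<close> edges
  corresponds to \<open>9 * ordered_loss S w \<le> 2 * n\<^sup>2\<close>.
\<close>

definition ordered_loss :: "'a set \<Rightarrow> ('a \<Rightarrow> real) \<Rightarrow> real" where
  "ordered_loss S w = (\<Sum>x\<in>S. \<Sum>y\<in>S. a x y * (w x * w y + (1 - w x) * (1 - w y)))"

lemma ordered_loss_half: "ordered_loss S (\<lambda>_. 1 / 2) = ordered_edges S / 2"
  by (simp add: ordered_loss_def ordered_edges_def sum_divide_distrib)

text \<open>
  The bipartition into the neighbourhood of \<open>v\<close> and its complement loses an edge \<open>x y\<close> if \<open>v\<close>
  is adjacent to both of its ends or to none, which happens for
  \<open>card S - deg S x - deg S y + 2 * codeg S x y\<close> vertices \<open>v\<close>. A vertex with minimal loss is at least as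
  good as the average over all \<open>v\<close>.
\<close>

lemma neighbourhood_cut:
  assumes "finite S" and "S \<noteq> {}"
  shows "\<exists>v\<in>S. (real (card S))\<^sup>2 * ordered_loss S (a v) \<le>
    (real (card S))\<^sup>2 * ordered_edges S - 2 * (ordered_edges S)\<^sup>2 +
    2 * real (card S) * ordered_triangles S"
proof -
  define N M T where "N = real (card S)" and "M = ordered_edges S" and "T = ordered_triangles S"
  have "(\<Sum>v\<in>S. ordered_loss S (a v)) =
    (\<Sum>x\<in>S. \<Sum>y\<in>S. \<Sum>v\<in>S. a x y * (a v x * a v y + (1 - a v x) * (1 - a v y)))"
    unfolding ordered_loss_def by (subst sum.swap) (rule sum.cong[OF refl], rule sum.swap)
  also have "\<dots> = (\<Sum>x\<in>S. \<Sum>y\<in>S. a x y * (N - (deg S x + deg S y) + 2 * codeg S x y))"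
  proof (intro sum.cong refl)
    fix x y
    have "(\<Sum>v\<in>S. a v x * a v y + (1 - a v x) * (1 - a v y)) =
      (\<Sum>v\<in>S. 1 - (a x v + a y v) + 2 * (a x v * a y v))"
      by (intro sum.cong refl) (simp add: algebra_simps sym[of _ x] sym[of _ y])
    also have "\<dots> = N - (deg S x + deg S y) + 2 * codeg S x y"
      by (simp add: N_def deg_def codeg_def sum.distrib sum_subtractf sum_distrib_left)
    finally show "(\<Sum>v\<in>S. a x y * (a v x * a v y + (1 - a v x) * (1 - a v y))) =
      a x y * (N - (deg S x + deg S y) + 2 * codeg S x y)"
      by (simp flip: sum_distrib_left)
  qed
  also have "\<dots> = N * M - 2 * (\<Sum>x\<in>S. (deg S x)\<^sup>2) + 2 * T"
    using sum_deg_over_edges[of S]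
    by (simp add: M_def T_def ordered_edges_def ordered_triangles_def sum_distrib_left
        algebra_simps sum.distrib sum_subtractf)
  finally have total: "(\<Sum>v\<in>S. ordered_loss S (a v)) = N * M - 2 * (\<Sum>x\<in>S. (deg S x)\<^sup>2) + 2 * T" .
  define v where "v = arg_min_on (\<lambda>v. ordered_loss S (a v)) S"
  have vS: "v \<in> S"
    unfolding v_def by (rule arg_min_if_finite(1)[OF assms])
  have v: "ordered_loss S (a v) \<le> ordered_loss S (a u)" if "u \<in> S" for u
    unfolding v_def by (rule arg_min_least[OF assms that])
  have "N * ordered_loss S (a v) \<le> (\<Sum>u\<in>S. ordered_loss S (a u))"
    unfolding N_def by (rule sum_bounded_below) (rule v)
  then have "N * (N * ordered_loss S (a v)) \<le> N * (N * M - 2 * (\<Sum>x\<in>S. (deg S x)\<^sup>2) + 2 * T)"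
    unfolding total by (intro mult_left_mono) (auto simp: N_def)
  moreover have "M\<^sup>2 \<le> N * (\<Sum>x\<in>S. (deg S x)\<^sup>2)"
    using ordered_edges_squared_le_sum_deg_squared[of S] by (simp add: M_def N_def)
  ultimately have "N\<^sup>2 * ordered_loss S (a v) \<le> N\<^sup>2 * M - 2 * M\<^sup>2 + 2 * N * T"
    by (simp add: power2_eq_square algebra_simps)
  then show ?thesis
    using vS unfolding N_def M_def T_def by (rule bexI)
qed

text \<open>
  For a triangle \<open>x y z\<close> this is the indicator of the set of vertices in none of the three common
  neighbourhoods.
\<close>

definition outside :: "'a \<Rightarrow> 'a \<Rightarrow> 'a \<Rightarrow> 'a \<Rightarrow> real" where
  "outside x y z u = 1 - (a x u * a y u + a y u * a z u + a x u * a z u)"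

lemma sum_outside: "(\<Sum>u\<in>S. outside x y z u) = card S - codeg_sum S x y z"
  by (simp add: outside_def codeg_sum_def codeg_def sum.distrib sum_subtractf)

lemma outside_zero_one:
  assumes "a x y = 1" "a y z = 1" "a x z = 1"
  shows "outside x y z u = 0 \<or> outside x y z u = 1"
  using common_neighbourhoods_disjoint[OF assms, of u] by (auto simp: outside_def)

lemma common_neighbourhood_independent:
  assumes "a x y = 1" "a u v = 1"
  shows "a x u * a y u = 0 \<or> a x v * a y v = 0"
  using K4_free[of x y u v] assms zero_one[of x u] zero_one[of y u] zero_one[of x v] zero_one[of y v]
  by auto

text \<open>Turan's bound applies to the subgraph induced by the vertices outside.\<close>

lemma outside_edges_le:
  assumes "finite S" and tri: "a x y = 1" "a y z = 1" "a x z = 1"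
  shows "3 * (\<Sum>u\<in>S. \<Sum>v\<in>S. a u v * (outside x y z u * outside x y z v)) \<le>
    2 * (card S - codeg_sum S x y z)\<^sup>2"
proof -
  let ?r = "outside x y z"
  define R where "R = {u \<in> S. ?r u = 1}"
  have r: "?r u = of_bool (u \<in> R)" if "u \<in> S" for u
    using outside_zero_one[OF tri, of u] that by (auto simp: R_def)
  have "R \<subseteq> S" by (auto simp: R_def)
  have "(\<Sum>u\<in>S. \<Sum>v\<in>S. a u v * (?r u * ?r v)) = (\<Sum>u\<in>S. of_bool (u \<in> R) * (\<Sum>v\<in>R. a u v))"
  proof (rule sum.cong[OF refl])
    fix u assume "u \<in> S"
    have "(\<Sum>v\<in>R. a u v) = (\<Sum>v\<in>S. a u v * ?r v)"
      using assms(1) \<open>R \<subseteq> S\<close> r by (intro sum.mono_neutral_cong_left) auto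
    then show "(\<Sum>v\<in>S. a u v * (?r u * ?r v)) = of_bool (u \<in> R) * (\<Sum>v\<in>R. a u v)"
      using r[OF \<open>u \<in> S\<close>] by (simp add: sum_distrib_left)
  qed
  also have "\<dots> = ordered_edges R"
    unfolding ordered_edges_def
    using assms(1) \<open>R \<subseteq> S\<close> by (intro sum.mono_neutral_cong_right) auto
  finally have edges: "(\<Sum>u\<in>S. \<Sum>v\<in>S. a u v * (?r u * ?r v)) = ordered_edges R" .
  have "(\<Sum>u\<in>S. ?r u) = (\<Sum>u\<in>S. of_bool (u \<in> R))"
    using r by simp
  also have "\<dots> = card R"
    using assms(1) \<open>R \<subseteq> S\<close> by (simp add: Int_absorb1)
  finally show ?thesis
    unfolding edges sum_outside using turan[of R] finite_subset[OF \<open>R \<subseteq> S\<close> assms(1)] by simp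
qed

text \<open>
  Each \<open>w\<close> among \<open>w1\<close>, \<open>w2\<close>, \<open>w3\<close> below singles out one common neighbourhood. Summed over these
  three cuts, an edge between two different common neighbourhoods is lost once, namely when
  neither of the two is singled out. An edge from a common neighbourhood to the outside is lost
  \<open>2 - p\<close> times on average, and an edge outside \<open>3 * (p\<^sup>2 + (1 - p)\<^sup>2)\<close> times, which exceeds
  \<open>2 - p\<close> by the coefficient \<open>1 - 5 * p + 6 * p\<^sup>2\<close>.
\<close>

lemma triangle_cut:
  assumes "finite S" and tri: "a x y = 1" "a y z = 1" "a x z = 1"
    and p: "0 \<le> p" "p \<le> 1" and nonneg_coeff: "0 \<le> 1 - 5 * p + 6 * p\<^sup>2"
  shows "\<exists>w. (\<forall>u. 0 \<le> w u \<and> w u \<le> 1) \<and> 9 * ordered_loss S w \<le>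
    3 * (2 - p) * ordered_edges S + 2 * (1 - 5 * p + 6 * p\<^sup>2) * (card S - codeg_sum S x y z)\<^sup>2"
proof -
  define q1 q2 q3 r where "q1 u = a x u * a y u" and "q2 u = a y u * a z u"
    and "q3 u = a x u * a z u" and "r = outside x y z" for u
  have cells: "(q1 u, q2 u, q3 u, r u) \<in> {(1, 0, 0, 0), (0, 1, 0, 0), (0, 0, 1, 0), (0, 0, 0, 1)}" for u
    using K4_free[of x y z u] tri zero_one[of x u] zero_one[of y u] zero_one[of z u]
    by (elim disjE) (simp_all add: q1_def q2_def q3_def r_def outside_def)
  define w1 w2 w3 where "w1 u = q1 u + p * r u" and "w2 u = q2 u + p * r u"
    and "w3 u = q3 u + p * r u" for u
  have range: "0 \<le> w u \<and> w u \<le> 1" if "w \<in> {w1, w2, w3}" for w u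
    using that p cells[of u] by (auto simp: w1_def w2_def w3_def)
  define g where "g w u v = w u * w v + (1 - w u) * (1 - w v)" for w :: "'a \<Rightarrow> real" and u v
  have "ordered_loss S w1 + ordered_loss S w2 + ordered_loss S w3 = (\<Sum>u\<in>S. \<Sum>v\<in>S. a u v * (g w1 u v + g w2 u v + g w3 u v))"
    by (simp add: ordered_loss_def g_def distrib_left sum.distrib)
  also have "\<dots> \<le> (\<Sum>u\<in>S. \<Sum>v\<in>S. (2 - p) * a u v + (1 - 5 * p + 6 * p\<^sup>2) * (a u v * (r u * r v)))"
  proof (intro sum_mono)
    fix u v
    show "a u v * (g w1 u v + g w2 u v + g w3 u v) \<le>
      (2 - p) * a u v + (1 - 5 * p + 6 * p\<^sup>2) * (a u v * (r u * r v))"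
    proof (cases "a u v = 0")
      case False
      then have uv: "a u v = 1" using zero_one[of u v] by simp
      have "q1 u = 0 \<or> q1 v = 0" "q2 u = 0 \<or> q2 v = 0" "q3 u = 0 \<or> q3 v = 0"
        unfolding q1_def q2_def q3_def by (rule common_neighbourhood_independent[OF _ uv], rule tri)+
      then show ?thesis
        using cells[of u] cells[of v] p
        by (auto simp: uv g_def w1_def w2_def w3_def power2_eq_square algebra_simps)
    qed simp
  qed
  also have "\<dots> = (2 - p) * ordered_edges S +
    (1 - 5 * p + 6 * p\<^sup>2) * (\<Sum>u\<in>S. \<Sum>v\<in>S. a u v * (r u * r v))"
    by (simp only: ordered_edges_def sum.distrib sum_distrib_left)
  finally have "3 * (ordered_loss S w1 + ordered_loss S w2 + ordered_loss S w3) \<le> 3 * (2 - p) * ordered_edges S +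
    (1 - 5 * p + 6 * p\<^sup>2) * (3 * (\<Sum>u\<in>S. \<Sum>v\<in>S. a u v * (r u * r v)))"
    by (simp add: algebra_simps)
  also have "\<dots> \<le> 3 * (2 - p) * ordered_edges S +
    (1 - 5 * p + 6 * p\<^sup>2) * (2 * (card S - codeg_sum S x y z)\<^sup>2)"
    by (intro add_left_mono mult_left_mono outside_edges_le[OF assms(1) tri, folded r_def] nonneg_coeff)
  finally have sum_le: "3 * (ordered_loss S w1 + ordered_loss S w2 + ordered_loss S w3) \<le>
    3 * (2 - p) * ordered_edges S + 2 * (1 - 5 * p + 6 * p\<^sup>2) * (card S - codeg_sum S x y z)\<^sup>2"
    by (simp add: algebra_simps)
  obtain w where w: "w \<in> {w1, w2, w3}" "3 * ordered_loss S w \<le> ordered_loss S w1 + ordered_loss S w2 + ordered_loss S w3"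
  proof (cases "ordered_loss S w1 \<le> ordered_loss S w2")
    case True
    then show ?thesis using that[of w1] that[of w3] by (cases "ordered_loss S w1 \<le> ordered_loss S w3") auto
  next
    case False
    then show ?thesis using that[of w2] that[of w3] by (cases "ordered_loss S w2 \<le> ordered_loss S w3") auto
  qed
  have "9 * ordered_loss S w \<le> 3 * (ordered_loss S w1 + ordered_loss S w2 + ordered_loss S w3)"
    using mult_left_mono[OF w(2), of 3] by simp
  with range[OF w(1)] sum_le show ?thesis by (meson order_trans)
qed

end

section \<open>One of the cuts is always good enough\<close>

text \<open>
  Here \<open>m\<close> is the number of edges divided by \<open>n\<^sup>2\<close>, \<open>t\<close> is six times the number of triangles divided
  by \<open>n\<^sup>3\<close>, and \<open>r\<close> is the proportion of vertices outside the common neighbourhoods of the chosen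
  triangle. The last three assumptions say that the neighbourhood cut and the triangle cuts with
  \<open>p = 1\<close> and \<open>p = 3 / 4\<close> fail. Failure of the neighbourhood cut bounds \<open>t\<close> from below and hence
  \<open>r\<close> from above, whereas failure of a triangle cut bounds \<open>r\<close> from below. The cut with \<open>p = 1\<close> is optimal
  at \<open>m = 1 / 3\<close>, but insufficient close to \<open>m = 2 / 9\<close>, where \<open>e(R)\<close> is large and splitting \<open>R\<close> pays off.
\<close>

lemma cut_bounds_incompatible:
  fixes m t r :: real
  assumes m: "2 / 9 \<le> m" "m < 1 / 3" and r: "0 \<le> r"
    and outside: "2 * m * r \<le> 2 * m - 3 * t"
    and nbhd: "1 / 9 \<le> m - 4 * m\<^sup>2 + t"
    and c1: "1 / 9 \<le> m / 3 + 2 / 9 * r\<^sup>2"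
    and c2: "1 / 9 \<le> 5 / 12 * m + 5 / 72 * r\<^sup>2"
  shows False
proof -
  have r_le: "6 * m * r \<le> (12 * m - 1) * (1 - 3 * m)"
    using outside nbhd by (simp add: algebra_simps power2_eq_square)
  show False
    \<comment> \<open>Any threshold in a small interval around \<open>4 / 17\<close> separates the two regimes.\<close>
  proof (cases "m \<le> 4 / 17")
    case True
    \<comment> \<open>Equality holds at \<open>m = 2 / 9\<close>, where the upper bound for \<open>r\<close> is largest.\<close>
    have "(12 * m - 1) * (1 - 3 * m) \<le> 5 / 2 * m"
    proof -
      have "0 \<le> (9 * m - 2) * (8 * m - 1)" using m by simp
      then show ?thesis by (simp add: algebra_simps power2_eq_square)
    qed
    with r_le have "m * (12 * r) \<le> m * 5" by simp
    then have "r \<le> 5 / 12" using m by simp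
    then have "r\<^sup>2 \<le> (5 / 12)\<^sup>2" using r by (rule power_mono)
    with c2 True show False by (simp add: power2_eq_square)
  next
    case False
    have "(6 * m * r)\<^sup>2 \<le> ((12 * m - 1) * (1 - 3 * m))\<^sup>2"
      using r_le m r by (intro power_mono) auto
    moreover have "36 * m\<^sup>2 * (2 * r\<^sup>2) = 2 * (6 * m * r)\<^sup>2"
      by (simp add: power_mult_distrib)
    ultimately have "36 * m\<^sup>2 * (2 * r\<^sup>2) \<le> 2 * ((12 * m - 1)\<^sup>2 * (1 - 3 * m)\<^sup>2)"
      using power_mult_distrib[of "12 * m - 1" "1 - 3 * m" 2] by linarith
    moreover have "36 * m\<^sup>2 * (1 - 3 * m) \<le> 36 * m\<^sup>2 * (2 * r\<^sup>2)"
      using c1 by (intro mult_left_mono) auto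
    moreover have "2 * ((1 - 3 * m) * (18 * m\<^sup>2)) = 36 * m\<^sup>2 * (1 - 3 * m)"
      "2 * ((1 - 3 * m) * ((12 * m - 1)\<^sup>2 * (1 - 3 * m))) = 2 * ((12 * m - 1)\<^sup>2 * (1 - 3 * m)\<^sup>2)"
      by (simp_all add: power2_eq_square)
    ultimately have "(1 - 3 * m) * (18 * m\<^sup>2) \<le> (1 - 3 * m) * ((12 * m - 1)\<^sup>2 * (1 - 3 * m))"
      by linarith
    then have "18 * m\<^sup>2 \<le> (12 * m - 1)\<^sup>2 * (1 - 3 * m)"
      using m by simp
    moreover have "(12 * m - 1)\<^sup>2 * (1 - 3 * m) < 18 * m\<^sup>2"
    proof -
      \<comment> \<open>The Taylor expansion at \<open>4 / 17\<close> has only positive coefficients.\<close>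
      define d where "d = m - 4 / 17"
      have d: "0 \<le> d" using False by (simp add: d_def)
      have m_eq: "m = 4 / 17 + d" by (simp add: d_def)
      have "18 * m\<^sup>2 - (12 * m - 1)\<^sup>2 * (1 - 3 * m) =
        432 * d ^ 3 + 1818 / 17 * d\<^sup>2 + 1611 / 289 * d + 91 / 4913"
        unfolding m_eq by (simp add: power2_eq_square power3_eq_cube field_simps)
      then show ?thesis
        using d zero_le_power[OF d, of 2] zero_le_power[OF d, of 3] by linarith
    qed
    ultimately show False by linarith
  qed
qed

context K4_free_adjacency
begin

lemma good_fractional_cut:
  assumes "finite S" and "S \<noteq> {}" and not_extremal: "3 * ordered_edges S \<noteq> 2 * (card S)\<^sup>2"
  shows "\<exists>w. (\<forall>u\<in>S. 0 \<le> w u \<and> w u \<le> 1) \<and> 9 * ordered_loss S w < 2 * (card S)\<^sup>2"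
proof (rule ccontr)
  define N M T where "N = real (card S)" and "M = ordered_edges S" and "T = ordered_triangles S"
  assume neg: "\<not> ?thesis"
  have large: "2 * N\<^sup>2 \<le> 9 * ordered_loss S w" if "\<And>u. 0 \<le> w u \<and> w u \<le> 1" for w
  proof (rule ccontr)
    assume "\<not> 2 * N\<^sup>2 \<le> 9 * ordered_loss S w"
    then have "9 * ordered_loss S w < 2 * (card S)\<^sup>2" by (simp add: N_def)
    then have "(\<forall>u\<in>S. 0 \<le> w u \<and> w u \<le> 1) \<and> 9 * ordered_loss S w < 2 * (card S)\<^sup>2"
      using that by simp
    then show False using neg by (rule notE[rotated, OF exI])
  qed
  have N: "0 < N" using assms by (auto simp: N_def card_gt_0_iff)
  define m t where "m = M / (2 * N\<^sup>2)" and "t = T / N ^ 3"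
  have M_eq: "M = 2 * m * N\<^sup>2" and T_eq: "T = t * N ^ 3"
    using N by (simp_all add: m_def t_def)
  have "4 * N\<^sup>2 \<le> 9 * M"
    using large[of "\<lambda>_. 1 / 2"] by (simp add: ordered_loss_half M_def)
  then have m_ge: "2 / 9 \<le> m" using N by (simp add: M_eq)
  have "3 * M < 2 * N\<^sup>2"
    using turan[OF assms(1)] not_extremal by (simp add: M_def N_def)
  then have m_less: "m < 1 / 3" using N by (simp add: M_eq)
  have nbhd: "1 / 9 \<le> m - 4 * m\<^sup>2 + t"
  proof -
    obtain v where v: "N\<^sup>2 * ordered_loss S (a v) \<le> N\<^sup>2 * M - 2 * M\<^sup>2 + 2 * N * T"
      using neighbourhood_cut[OF assms(1,2), folded N_def M_def T_def] by (elim bexE)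
    have "N\<^sup>2 * (2 * N\<^sup>2) \<le> N\<^sup>2 * (9 * ordered_loss S (a v))"
      using large[of "a v"] nonneg le_one by (intro mult_left_mono) auto
    with v have "2 * N ^ 4 \<le> 9 * (N\<^sup>2 * M - 2 * M\<^sup>2 + 2 * N * T)"
      by (simp add: power2_eq_square power4_eq_xxxx)
    also have "\<dots> = N ^ 4 * (18 * (m - 4 * m\<^sup>2 + t))"
      by (simp add: M_eq T_eq power2_eq_square power3_eq_cube power4_eq_xxxx algebra_simps)
    finally have "N ^ 4 * 2 \<le> N ^ 4 * (18 * (m - 4 * m\<^sup>2 + t))" by simp
    then show ?thesis using N by simp
  qed
  \<comment> \<open>The failing neighbourhood cuts force the existence of a triangle.\<close>
  have "t \<noteq> 0"
  proof
    assume "t = 0"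
    have "0 \<le> (6 * m - 3 / 4)\<^sup>2" by simp
    with nbhd \<open>t = 0\<close> show False by (simp add: power2_eq_square algebra_simps)
  qed
  then have "0 < T"
    using N ordered_triangles_nonneg[of S] by (simp add: t_def T_def less_le)
  then obtain x y z where tri: "a x y = 1" "a y z = 1" "a x z = 1"
    and codeg: "3 * T \<le> M * codeg_sum S x y z"
    using triangle_with_large_codeg_sum[OF assms(1)] unfolding T_def M_def by blast
  define r where "r = (N - codeg_sum S x y z) / N"
  have codeg_eq: "codeg_sum S x y z = N * (1 - r)" and outside_eq: "N - codeg_sum S x y z = N * r"
    using N by (simp_all add: r_def field_simps)
  have r: "0 \<le> r"
    using codeg_sum_le[OF tri, of S] N by (simp add: r_def N_def)
  have outside: "2 * m * r \<le> 2 * m - 3 * t"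
  proof -
    have "N ^ 3 * (3 * t) \<le> N ^ 3 * (2 * m * (1 - r))"
      using codeg unfolding codeg_eq M_eq T_eq
      by (simp add: power2_eq_square power3_eq_cube mult_ac)
    then have "3 * t \<le> 2 * m * (1 - r)" using N by simp
    then show ?thesis by (simp add: algebra_simps)
  qed
  have cut: "2 \<le> 6 * (2 - p) * m + 2 * (1 - 5 * p + 6 * p\<^sup>2) * r\<^sup>2"
    if p: "0 \<le> p" "p \<le> 1" "0 \<le> 1 - 5 * p + 6 * p\<^sup>2" for p
  proof -
    have "\<exists>w. (\<forall>u. 0 \<le> w u \<and> w u \<le> 1) \<and>
      9 * ordered_loss S w \<le> 3 * (2 - p) * M + 2 * (1 - 5 * p + 6 * p\<^sup>2) * (N * r)\<^sup>2"
      unfolding outside_eq[symmetric] unfolding N_def M_def by (rule triangle_cut[OF assms(1) tri p])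
    then obtain w where w: "\<forall>u. 0 \<le> w u \<and> w u \<le> 1"
      "9 * ordered_loss S w \<le> 3 * (2 - p) * M + 2 * (1 - 5 * p + 6 * p\<^sup>2) * (N * r)\<^sup>2"
      by (elim exE conjE)
    have "2 * N\<^sup>2 \<le> 9 * ordered_loss S w" using large w(1) by simp
    also note w(2)
    also have "3 * (2 - p) * M + 2 * (1 - 5 * p + 6 * p\<^sup>2) * (N * r)\<^sup>2 =
      N\<^sup>2 * (6 * (2 - p) * m + 2 * (1 - 5 * p + 6 * p\<^sup>2) * r\<^sup>2)"
      by (simp add: M_eq power_mult_distrib algebra_simps)
    finally have "N\<^sup>2 * 2 \<le> N\<^sup>2 * (6 * (2 - p) * m + 2 * (1 - 5 * p + 6 * p\<^sup>2) * r\<^sup>2)"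
      by (simp only: mult.commute[of 2])
    then show ?thesis using N by simp
  qed
  have "1 / 9 \<le> m / 3 + 2 / 9 * r\<^sup>2"
    using cut[of 1] by simp
  moreover have coeff: "1 - 5 * (3 / 4) + 6 * (3 / 4)\<^sup>2 = (5 / 8 :: real)"
    by (simp add: power2_eq_square)
  have "1 / 9 \<le> 5 / 12 * m + 5 / 72 * r\<^sup>2"
    using cut[of "3 / 4"] unfolding coeff by simp
  ultimately show False
    by (rule cut_bounds_incompatible[OF m_ge m_less r outside nbhd])
qed

end

section \<open>The extremal graph\<close>

context K4_free_adjacency
begin

text \<open>
  Equality in Turan's bound makes the upper and lower bounds on the number of triangles meet, and
  then the common neighbourhoods of some triangle cover all vertices. They are independent and
  serve as colour classes, of sizes \<open>n i\<close> say. The number of non-adjacent pairs with different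
  colours is minus the sum of the squared deviations of the \<open>n i\<close> from \<open>card S / 3\<close>, so both are
  zero.
\<close>

lemma extremal_is_balanced_tripartite:
  assumes "finite S" and "S \<noteq> {}" and extremal: "3 * ordered_edges S = 2 * (card S)\<^sup>2"
  obtains c :: "'a \<Rightarrow> nat"
  where "\<And>u. u \<in> S \<Longrightarrow> c u < 3"
    and "\<And>i. i < 3 \<Longrightarrow> 3 * card {u \<in> S. c u = i} = card S"
    and "\<And>u v. u \<in> S \<Longrightarrow> v \<in> S \<Longrightarrow> a u v = of_bool (c u \<noteq> c v)"
proof -
  define N M T where "N = real (card S)" and "M = ordered_edges S" and "T = ordered_triangles S"
  have N: "0 < N" using assms by (auto simp: N_def card_gt_0_iff)
  have M_eq: "M = 2 / 3 * N\<^sup>2" using extremal by (simp add: M_def N_def)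
  have "M * M \<le> N * (\<Sum>x\<in>S. (deg S x)\<^sup>2)"
    using ordered_edges_squared_le_sum_deg_squared[of S] by (simp add: M_def N_def power2_eq_square)
  moreover have "N * (2 * (\<Sum>x\<in>S. (deg S x)\<^sup>2)) \<le> N * (N * M + T)"
    using sum_deg_squared_le[of S] N by (intro mult_left_mono) (auto simp: M_def N_def T_def)
  ultimately have "2 * (M * M) \<le> N * (N * M + T)" by linarith
  then have "N * (2 * N ^ 3) \<le> N * (9 * T)"
    by (simp add: M_eq power2_eq_square power3_eq_cube algebra_simps)
  then have T_ge: "2 * N ^ 3 \<le> 9 * T" using N by simp
  moreover have "0 < N ^ 3" using N by simp
  ultimately have "0 < T" by linarith
  then obtain x y z where tri: "a x y = 1" "a y z = 1" "a x z = 1"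
    and codeg: "3 * T \<le> M * codeg_sum S x y z"
    using triangle_with_large_codeg_sum[OF assms(1)] unfolding T_def M_def by blast
  have "(2 / 3 * N\<^sup>2) * N \<le> (2 / 3 * N\<^sup>2) * codeg_sum S x y z"
    using T_ge codeg by (simp add: M_eq power2_eq_square power3_eq_cube)
  then have "N \<le> codeg_sum S x y z" using N by simp
  then have "(\<Sum>u\<in>S. outside x y z u) \<le> 0" by (simp add: sum_outside N_def)
  moreover have outside_nonneg: "0 \<le> outside x y z u" for u
    using outside_zero_one[OF tri, of u] by auto
  ultimately have "(\<Sum>u\<in>S. outside x y z u) = 0"
    by (intro antisym sum_nonneg)
  then have outside_0: "outside x y z u = 0" if "u \<in> S" for u
    using sum_nonneg_eq_0_iff[OF assms(1), of "outside x y z"] outside_nonneg that by blast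
  define c :: "'a \<Rightarrow> nat" where
    "c u = (if a x u * a y u = 1 then 0 else if a y u * a z u = 1 then 1 else 2)" for u
  have c: "c u < 3" and c3: "c u = 0 \<or> c u = 1 \<or> c u = 2" for u by (simp_all add: c_def)
  have common: "(c u = 0 \<longrightarrow> a x u * a y u = 1) \<and> (c u = 1 \<longrightarrow> a y u * a z u = 1) \<and>
    (c u = 2 \<longrightarrow> a x u * a z u = 1)" if "u \<in> S" for u
    using outside_0[OF that] zero_one[of x u] zero_one[of y u] zero_one[of z u]
    by (auto simp: c_def outside_def)
  have proper: "c u \<noteq> c v" if "u \<in> S" "v \<in> S" "a u v = 1" for u v
  proof
    assume eq: "c u = c v"
    have "c u \<noteq> 0"
      using common[OF that(1)] common[OF that(2)] eq
        common_neighbourhood_independent[OF tri(1) that(3)] by linarith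
    moreover have "c u \<noteq> 1"
      using common[OF that(1)] common[OF that(2)] eq
        common_neighbourhood_independent[OF tri(2) that(3)] by linarith
    moreover have "c u \<noteq> 2"
      using common[OF that(1)] common[OF that(2)] eq
        common_neighbourhood_independent[OF tri(3) that(3)] by linarith
    ultimately show False using c3[of u] by simp
  qed
  define n where "n i = real (card {u \<in> S. c u = i})" for i
  have n_eq: "n i = (\<Sum>u\<in>S. of_bool (c u = i))" for i
    using assms(1) by (simp add: n_def Int_def)
  have upto3: "{..<3::nat} = {0, 1, 2}" by auto
  have one: "(\<Sum>i<3. of_bool (c u = i)) = (1::real)" for u
    using c3[of u] unfolding upto3 by (elim disjE) (simp_all del: sum_of_bool_eq)
  have sum_n: "(\<Sum>i<3. n i) = N"
    unfolding n_eq by (subst sum.swap) (simp only: one, simp add: N_def)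
  have same: "(\<Sum>u\<in>S. \<Sum>v\<in>S. of_bool (c u = c v)) = (\<Sum>i<3. (n i)\<^sup>2)"
  proof -
    have "(\<Sum>i<3. (n i)\<^sup>2) = (\<Sum>i<3. \<Sum>u\<in>S. \<Sum>v\<in>S. of_bool (c u = i) * of_bool (c v = i))"
      unfolding n_eq power2_eq_square by (simp only: sum_product)
    also have "\<dots> = (\<Sum>u\<in>S. \<Sum>v\<in>S. \<Sum>i<3. of_bool (c u = i) * of_bool (c v = i))"
      by (subst sum.swap) (rule sum.cong[OF refl], rule sum.swap)
    also have "\<dots> = (\<Sum>u\<in>S. \<Sum>v\<in>S. of_bool (c u = c v))"
    proof (intro sum.cong refl)
      fix u v
      show "(\<Sum>i<3. of_bool (c u = i) * of_bool (c v = i)) = (of_bool (c u = c v) :: real)"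
        using c3[of u] c3[of v] unfolding upto3
        by (elim disjE) (simp_all del: sum_of_bool_eq)
    qed
    finally show ?thesis by simp
  qed
  define gap where "gap u v = of_bool (c u \<noteq> c v) - a u v" for u v
  have gap_nonneg: "0 \<le> gap u v" if "u \<in> S" "v \<in> S" for u v
    using proper[OF that] zero_one[of u v] by (auto simp: gap_def)
  have "(\<Sum>u\<in>S. \<Sum>v\<in>S. gap u v) = (\<Sum>u\<in>S. \<Sum>v\<in>S. 1 - of_bool (c u = c v) - a u v)"
    by (intro sum.cong refl) (simp add: gap_def of_bool_not_iff)
  also have "\<dots> = N\<^sup>2 - (\<Sum>i<3. (n i)\<^sup>2) - M"
    by (simp only: sum_subtractf same) (simp add: N_def M_def ordered_edges_def power2_eq_square)
  also have "\<dots> = - (\<Sum>i<3. (n i - N / 3)\<^sup>2)"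
  proof -
    have "(\<Sum>i<3. (n i - N / 3)\<^sup>2) =
      (\<Sum>i<3. (n i)\<^sup>2) - 2 / 3 * N * (\<Sum>i<3. n i) + N\<^sup>2 / 3"
      unfolding upto3 by (simp add: power2_eq_square field_simps)
    then show ?thesis unfolding sum_n by (simp add: M_eq power2_eq_square)
  qed
  finally have gap_sum: "(\<Sum>u\<in>S. \<Sum>v\<in>S. gap u v) = - (\<Sum>i<3. (n i - N / 3)\<^sup>2)" .
  have "0 \<le> (\<Sum>u\<in>S. \<Sum>v\<in>S. gap u v)"
    by (intro sum_nonneg gap_nonneg)
  moreover have "0 \<le> (\<Sum>i<3. (n i - N / 3)\<^sup>2)"
    by (intro sum_nonneg zero_le_power2)
  ultimately have gap_0: "(\<Sum>u\<in>S. \<Sum>v\<in>S. gap u v) = 0" and dev_0: "(\<Sum>i<3. (n i - N / 3)\<^sup>2) = 0"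
    using gap_sum by linarith+
  have sizes: "3 * card {u \<in> S. c u = i} = card S" if "i < 3" for i
  proof -
    have "(n i - N / 3)\<^sup>2 = 0"
      by (rule sum_nonneg_0[OF _ _ dev_0]) (use that in simp_all)
    then have "3 * real (card {u \<in> S. c u = i}) = real (card S)"
      by (simp add: n_def N_def)
    then show ?thesis by linarith
  qed
  have adj_eq: "a u v = of_bool (c u \<noteq> c v)" if "u \<in> S" "v \<in> S" for u v
  proof -
    have row: "(\<Sum>v\<in>S. gap u v) = 0"
      by (rule sum_nonneg_0[OF assms(1) _ gap_0 that(1)]) (intro sum_nonneg gap_nonneg)
    have "gap u v = 0"
      by (rule sum_nonneg_0[OF assms(1) _ row that(2)]) (rule gap_nonneg[OF that(1)])
    then show ?thesis by (simp add: gap_def)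
  qed
  show ?thesis
    by (rule that[OF c sizes adj_eq])
qed

text \<open>
  With \<open>n\<^sup>2 / 3\<close> edges, already the upper bound on the number of triangles makes a neighbourhood cut
  good enough.
\<close>

lemma extremal_cut:
  assumes "finite S" and "S \<noteq> {}" and extremal: "3 * ordered_edges S = 2 * (card S)\<^sup>2"
  shows "\<exists>v\<in>S. 9 * ordered_loss S (a v) \<le> 2 * (card S)\<^sup>2"
proof -
  define N M T where "N = real (card S)" and "M = ordered_edges S" and "T = ordered_triangles S"
  have N: "0 < N" using assms by (auto simp: N_def card_gt_0_iff)
  have M_eq: "M = 2 / 3 * N\<^sup>2" using extremal by (simp add: M_def N_def)
  obtain v where v: "v \<in> S" "N\<^sup>2 * ordered_loss S (a v) \<le> N\<^sup>2 * M - 2 * M\<^sup>2 + 2 * N * T"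
    using neighbourhood_cut[OF assms(1,2), folded N_def M_def T_def] by (elim bexE)
  have "N * (3 * T) \<le> N * (M * N)"
    using ordered_triangles_le[OF assms(1)] N by (intro mult_left_mono) (auto simp: N_def M_def T_def)
  with v(2) have "N\<^sup>2 * (9 * ordered_loss S (a v)) \<le> N\<^sup>2 * (2 * N\<^sup>2)"
    by (simp add: M_eq power2_eq_square algebra_simps)
  then have "9 * ordered_loss S (a v) \<le> 2 * N\<^sup>2" using N by simp
  then show ?thesis using v(1) by (auto simp: N_def)
qed

end

lemma tripartite_isomorphism_of_colouring:
  fixes c :: "'a \<Rightarrow> nat"
  assumes "finite V" and c: "\<And>u. u \<in> V \<Longrightarrow> c u < 3"
    and size: "\<And>i. i < 3 \<Longrightarrow> card {u \<in> V. c u = i} = k"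
    and edge: "\<And>u v. u \<in> V \<Longrightarrow> v \<in> V \<Longrightarrow> {u, v} \<in> E \<longleftrightarrow> c u \<noteq> c v"
  shows "graph_isomorphic V E (tripartite_verts k k k) (tripartite_edges k k k)"
proof -
  have "\<exists>g. bij_betw g {u \<in> V. c u = i} {..<k}" if "i < 3" for i
    using assms(1) size[OF that] ex_bij_betw_finite_nat[of "{u \<in> V. c u = i}"]
    by (simp add: atLeast0LessThan)
  then obtain g where g: "\<And>i. i < 3 \<Longrightarrow> bij_betw (g i) {u \<in> V. c u = i} {..<k}" by metis
  define f where "f u = (c u, g (c u) u)" for u
  have verts: "p \<in> tripartite_verts k k k \<longleftrightarrow> fst p < 3 \<and> snd p < k" for p
    by (cases p) (auto simp: tripartite_verts_def)
  have bij: "bij_betw f V (tripartite_verts k k k)"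
    unfolding bij_betw_def
  proof
    show "inj_on f V"
    proof (rule inj_onI)
      fix u v assume uv: "u \<in> V" "v \<in> V" "f u = f v"
      then have "c u = c v" "g (c u) u = g (c u) v" by (auto simp: f_def)
      then show "u = v"
        using uv bij_betw_imp_inj_on[OF g[OF c[OF uv(1)]]] by (auto dest: inj_onD)
    qed
    show "f ` V = tripartite_verts k k k"
    proof (intro equalityI subsetI)
      fix p assume "p \<in> f ` V"
      then obtain u where u: "u \<in> V" "p = f u" by blast
      then show "p \<in> tripartite_verts k k k"
        using c[OF u(1)] bij_betwE[OF g[OF c[OF u(1)]]] by (auto simp: verts f_def)
    next
      fix p assume "p \<in> tripartite_verts k k k"
      then have p: "fst p < 3" "snd p < k" by (auto simp: verts)
      have "snd p \<in> g (fst p) ` {u \<in> V. c u = fst p}"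
        unfolding bij_betw_imp_surj_on[OF g[OF p(1)]] using p(2) by simp
      then obtain u where "u \<in> V" "c u = fst p" "g (fst p) u = snd p" by auto
      then show "p \<in> f ` V" by (intro image_eqI[of _ _ u]) (auto simp: f_def)
    qed
  qed
  moreover have "{u, v} \<in> E \<longleftrightarrow> {f u, f v} \<in> tripartite_edges k k k" if "u \<in> V" "v \<in> V" for u v
  proof -
    have "f u \<in> tripartite_verts k k k" "f v \<in> tripartite_verts k k k"
      using bij_betwE[OF bij] that by auto
    then show ?thesis
      unfolding edge[OF that] tripartite_edges_def f_def by (auto simp: doubleton_eq_iff)
  qed
  ultimately show ?thesis
    unfolding graph_isomorphic_def by blast
qed

text \<open>
  The triangles \<open>(0, i)\<close>, \<open>(1, j)\<close>, \<open>(2, h i j)\<close> are edge-disjoint if \<open>h\<close> is a Latin square, because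
  any two of \<open>i\<close>, \<open>j\<close>, \<open>h i j\<close> determine the third. So \<open>D\<close> contains \<open>k\<^sup>2\<close> different edges.
\<close>

lemma card_ge_of_meeting_triangles:
  fixes D :: "(nat \<times> nat) set set"
  assumes "finite D"
    and meets: "\<And>i j l. i < k \<Longrightarrow> j < k \<Longrightarrow> l < k \<Longrightarrow>
      {(0, i), (1, j)} \<in> D \<or> {(1, j), (2, l)} \<in> D \<or> {(0, i), (2, l)} \<in> D"
  shows "k\<^sup>2 \<le> card D"
proof -
  \<comment> \<open>Addition modulo \<open>k\<close>.\<close>
  define h where "h i j = (if i + j < k then i + j else i + j - k)" for i j
  have h_less: "h i j < k" if "i < k" "j < k" for i j
    using that by (auto simp: h_def)
  have h_left: "i = i'" if "h i j = h i' j" "i < k" "i' < k" "j < k" for i i' j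
    using that by (auto simp: h_def split: if_splits)
  have h_right: "j = j'" if "h i j = h i j'" "i < k" "j < k" "j' < k" for i j j'
    using that by (auto simp: h_def split: if_splits)
  have "\<forall>p\<in>{..<k} \<times> {..<k}. \<exists>e. e \<in> D \<and> (e = {(0, fst p), (1, snd p)} \<or>
    e = {(1, snd p), (2, h (fst p) (snd p))} \<or> e = {(0, fst p), (2, h (fst p) (snd p))})"
  proof
    fix p assume "p \<in> {..<k} \<times> {..<k}"
    then have "fst p < k" "snd p < k" "h (fst p) (snd p) < k" by (auto intro: h_less)
    from meets[OF this] show "\<exists>e. e \<in> D \<and> (e = {(0, fst p), (1, snd p)} \<or>
      e = {(1, snd p), (2, h (fst p) (snd p))} \<or> e = {(0, fst p), (2, h (fst p) (snd p))})"
      by blast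
  qed
  from bchoice[OF this] obtain F where choice: "\<forall>p\<in>{..<k} \<times> {..<k}. F p \<in> D \<and>
    (F p = {(0, fst p), (1, snd p)} \<or> F p = {(1, snd p), (2, h (fst p) (snd p))} \<or>
      F p = {(0, fst p), (2, h (fst p) (snd p))})"
    by (elim exE)
  have F: "F (i, j) \<in> D" "F (i, j) = {(0, i), (1, j)} \<or> F (i, j) = {(1, j), (2, h i j)} \<or>
    F (i, j) = {(0, i), (2, h i j)}" if "i < k" "j < k" for i j
    using bspec[OF choice, of "(i, j)"] that by simp_all
  have "inj_on F ({..<k} \<times> {..<k})"
  proof (rule inj_onI)
    fix p q assume pq: "p \<in> {..<k} \<times> {..<k}" "q \<in> {..<k} \<times> {..<k}" "F p = F q"
    obtain i j i' j' where p: "p = (i, j)" and q: "q = (i', j')" by (cases p, cases q)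
    have lt: "i < k" "j < k" "i' < k" "j' < k" and eq: "F (i, j) = F (i', j')"
      using pq by (simp_all add: p q)
    have first: "F (i, j) = {(0, i), (1, j)} \<or> F (i, j) = {(1, j), (2, h i j)} \<or>
      F (i, j) = {(0, i), (2, h i j)}"
      using F(2) lt by simp
    have second: "F (i, j) = {(0, i'), (1, j')} \<or> F (i, j) = {(1, j'), (2, h i' j')} \<or>
      F (i, j) = {(0, i'), (2, h i' j')}"
      unfolding eq using F(2) lt by simp
    have "i = i' \<and> j = j' \<or> j = j' \<and> h i j = h i' j' \<or> i = i' \<and> h i j = h i' j'"
      using first second by (elim disjE; clarsimp simp: doubleton_eq_iff; metis)
    then show "p = q"
      using h_left[of i j i'] h_right[of i j j'] lt by (auto simp: p q)
  qed
  moreover have "F ` ({..<k} \<times> {..<k}) \<subseteq> D" using F(1) by auto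
  ultimately have "card ({..<k} \<times> {..<k}) \<le> card D"
    using assms(1) by (rule card_inj_on_le)
  then show ?thesis by (simp add: power2_eq_square)
qed

text \<open>
  Two of the three vertices of a triangle lie on the same side of a bipartition, and the edge
  between them must have been deleted.
\<close>

lemma tripartite_deletion_lower_bound:
  assumes iso: "graph_isomorphic V E (tripartite_verts k k k) (tripartite_edges k k k)"
    and "finite D" and bip: "bipartite V (E - D)"
  shows "k\<^sup>2 \<le> card D"
proof -
  obtain f where f: "bij_betw f V (tripartite_verts k k k)"
    and edge: "\<And>u v. u \<in> V \<Longrightarrow> v \<in> V \<Longrightarrow> {u, v} \<in> E \<longleftrightarrow> {f u, f v} \<in> tripartite_edges k k k"
    using iso unfolding graph_isomorphic_def by blast
  obtain A B where AB: "A \<union> B = V" "A \<inter> B = {}" "indep A (E - D)" "indep B (E - D)"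
    using bip unfolding bipartite_def by blast
  define h where "h = inv_into V f"
  have h: "h p \<in> V" "f (h p) = p" if "p \<in> tripartite_verts k k k" for p
    using f that unfolding h_def bij_betw_def by (auto intro: inv_into_into f_inv_into_f)
  have deleted: "{p, q} \<in> (`) f ` D"
    if "p \<in> tripartite_verts k k k" "q \<in> tripartite_verts k k k" "fst p \<noteq> fst q"
      "h p \<in> A \<longleftrightarrow> h q \<in> A" for p q
  proof -
    have "{h p, h q} \<in> E"
      unfolding edge[OF h(1)[OF that(1)] h(1)[OF that(2)]] h(2)[OF that(1)] h(2)[OF that(2)]
      unfolding tripartite_edges_def using that(1-3) by blast
    moreover have "h p \<noteq> h q" using h(2)[OF that(1)] h(2)[OF that(2)] that(3) by metis
    then have "{h p, h q} \<notin> E - D"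
      using AB that(4) h(1)[OF that(1)] h(1)[OF that(2)] unfolding indep_def by blast
    ultimately have "f ` {h p, h q} \<in> (`) f ` D" by blast
    then show ?thesis using h(2)[OF that(1)] h(2)[OF that(2)] by simp
  qed
  have "k\<^sup>2 \<le> card ((`) f ` D)"
  proof (rule card_ge_of_meeting_triangles)
    fix i j l assume lt: "i < k" "j < k" "l < k"
    have verts: "(0, i) \<in> tripartite_verts k k k" "(1, j) \<in> tripartite_verts k k k"
      "(2, l) \<in> tripartite_verts k k k"
      using lt by (auto simp: tripartite_verts_def)
    show "{(0, i), (1, j)} \<in> (`) f ` D \<or> {(1, j), (2, l)} \<in> (`) f ` D \<or> {(0, i), (2, l)} \<in> (`) f ` D"
      using deleted[OF verts(1,2)] deleted[OF verts(2,3)] deleted[OF verts(1,3)] by fastforce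
  qed (use assms(2) in simp)
  also have "\<dots> \<le> card D" using assms(2) by (rule card_image_le)
  finally show ?thesis .
qed

lemma K4_free_adjacency_adj:
  assumes "E \<subseteq> [V]\<^bsup>2\<^esup>" and "K4_free V E"
  shows "K4_free_adjacency (adj E)"
proof
  show "adj E x y = 0 \<or> adj E x y = 1" for x y by (simp add: adj_def)
  show "adj E x y = adj E y x" for x y by (simp add: adj_def insert_commute)
  show "\<not> (adj E x y = 1 \<and> adj E x z = 1 \<and> adj E x u = 1 \<and> adj E y z = 1 \<and> adj E y u = 1 \<and>
    adj E z u = 1)" for x y z u
  proof
    assume "adj E x y = 1 \<and> adj E x z = 1 \<and> adj E x u = 1 \<and> adj E y z = 1 \<and> adj E y u = 1 \<and>
      adj E z u = 1"
    then have edges: "{x, y} \<in> E" "{x, z} \<in> E" "{x, u} \<in> E" "{y, z} \<in> E" "{y, u} \<in> E" "{z, u} \<in> E"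
      by (auto simp: adj_def)
    then have "{x, y} \<in> [V]\<^bsup>2\<^esup>" "{x, z} \<in> [V]\<^bsup>2\<^esup>" "{x, u} \<in> [V]\<^bsup>2\<^esup>" "{y, z} \<in> [V]\<^bsup>2\<^esup>"
      "{y, u} \<in> [V]\<^bsup>2\<^esup>" "{z, u} \<in> [V]\<^bsup>2\<^esup>"
      using assms(1) by blast+
    then have "{x, y, z, u} \<subseteq> V" "card {x, y, z, u} = 4"
      by auto
    moreover have "clique {x, y, z, u} E"
      using edges unfolding clique_def by (auto simp: insert_commute)
    ultimately show False using assms(2) unfolding K4_free_def by blast
  qed
qed

theorem theorem1p1:
  fixes V :: "'a set" and E :: "'a set set" and n :: nat
  assumes "simple_graph V E" and "card V = n" and "K4_free V E"
  shows "(\<exists>D\<subseteq>E. bipartite V (E - D) \<and> real (card D) \<le> (real n)\<^sup>2 / 9) \<and>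
    ((\<forall>D\<subseteq>E. bipartite V (E - D) \<longrightarrow> real (card D) \<ge> (real n)\<^sup>2 / 9) \<longleftrightarrow>
      3 dvd n \<and>
      graph_isomorphic V E
        (tripartite_verts (n div 3) (n div 3) (n div 3))
        (tripartite_edges (n div 3) (n div 3) (n div 3)))"
proof -
  have V: "finite V" "V \<noteq> {}" and E: "E \<subseteq> [V]\<^bsup>2\<^esup>"
    using assms(1) by (auto simp: simple_graph_def)
  have finE: "finite E"
    using V(1) E finite_imp_finite_nsets finite_subset by blast
  interpret K4_free_adjacency "adj E"
    by (rule K4_free_adjacency_adj[OF E assms(3)])
  let ?iso = "graph_isomorphic V E (tripartite_verts (n div 3) (n div 3) (n div 3))
    (tripartite_edges (n div 3) (n div 3) (n div 3))"
  have deletion: "\<exists>D\<subseteq>E. bipartite V (E - D) \<and> 2 * real (card D) \<le> ordered_loss V w"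
    if "\<And>u. u \<in> V \<Longrightarrow> 0 \<le> w u \<and> w u \<le> 1" for w
    using bipartite_by_ordered_sum[OF V(1) E that] unfolding ordered_loss_def .
  have forced: "(real n)\<^sup>2 / 9 \<le> real (card D)"
    if "3 dvd n" ?iso "D \<subseteq> E" "bipartite V (E - D)" for D
  proof -
    have "(n div 3)\<^sup>2 \<le> card D"
      using tripartite_deletion_lower_bound[OF that(2) _ that(4)] finite_subset[OF that(3) finE] .
    moreover have "(real n)\<^sup>2 / 9 = real ((n div 3)\<^sup>2)"
      using that(1) by (auto elim!: dvdE simp: power_mult_distrib)
    ultimately show ?thesis by simp
  qed
  \<comment> \<open>The graphs with exactly \<open>n\<^sup>2 / 3\<close> edges turn out to be the extremal ones.\<close>
  show ?thesis
  proof (cases "3 * ordered_edges V = 2 * (card V)\<^sup>2")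
    case True
    obtain v where v: "9 * ordered_loss V (adj E v) \<le> 2 * (card V)\<^sup>2"
      using extremal_cut[OF V True] by blast
    obtain D where D: "D \<subseteq> E" "bipartite V (E - D)" "2 * real (card D) \<le> ordered_loss V (adj E v)"
      using deletion[of "adj E v"] nonneg le_one by blast
    have "real (card D) \<le> (real n)\<^sup>2 / 9"
      using D(3) v assms(2) by simp
    moreover obtain c :: "'a \<Rightarrow> nat" where c: "\<And>u. u \<in> V \<Longrightarrow> c u < 3"
      "\<And>i. i < 3 \<Longrightarrow> 3 * card {u \<in> V. c u = i} = card V"
      "\<And>u v. u \<in> V \<Longrightarrow> v \<in> V \<Longrightarrow> adj E u v = of_bool (c u \<noteq> c v)"
      using extremal_is_balanced_tripartite[OF V True] by blast
    have "3 dvd n" using c(2)[of 0] assms(2) by (metis dvd_triv_left zero_less_numeral)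
    moreover have ?iso
    proof (rule tripartite_isomorphism_of_colouring[OF V(1) c(1)])
      show "card {u \<in> V. c u = i} = n div 3" if "i < 3" for i
        using c(2)[OF that] assms(2) by simp
      show "{u, v} \<in> E \<longleftrightarrow> c u \<noteq> c v" if "u \<in> V" "v \<in> V" for u v
        using c(3)[OF that] unfolding adj_def by (simp only: of_bool_eq_iff)
    qed
    ultimately show ?thesis
      using D(1,2) forced by blast
  next
    case False
    obtain w where w: "\<forall>u\<in>V. 0 \<le> w u \<and> w u \<le> 1" "9 * ordered_loss V w < 2 * (card V)\<^sup>2"
      using good_fractional_cut[OF V False] by blast
    obtain D where D: "D \<subseteq> E" "bipartite V (E - D)" "2 * real (card D) \<le> ordered_loss V w"
      using deletion[of w] w(1) by blast
    have "real (card D) < (real n)\<^sup>2 / 9"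
      using D(3) w(2) assms(2) by simp
    then show ?thesis
      using D(1,2) forced by (meson less_imp_le not_le)
  qed
qed

end
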